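(* Let $\tau>0$ and let $Q_j\in\mathbb{R}^{n_j\times n}$, $j=1,\dots,d$, be the given matrices described in the context, with rows $\mathbf q_{j1}^\top,\dots,\mathbf q_{jn_j}^\top$. For $\mathbf y\in\mathbb{R}^n$ let $\{\hat\theta_0(\mathbf y),\{\hat{\boldsymbol\theta}_j(\mathbf y)\}_{j=1}^d\}$ be a solution of the additive generalized total variation regression problem $$\min_{\theta_0\in\mathbb{R},\ \boldsymbol\theta_1,\dots,\boldsymbol\theta_d\in\mathbb{R}^n}\ \frac12\Big\|\mathbf y-\sum_{j=1}^d\boldsymbol\theta_j-\theta_0\mathbf 1\Big\|_2^2+\tau\sum_{j=1}^d\|Q_j\boldsymbol\theta_j\|_1\quad\text{s.t.}\quad\mathbf 1^\top\boldsymbol\theta_j=0,\ 1\le j\le d,$$ and let $\hat{\boldsymbol\theta}(\mathbf y)=\sum_{j=1}^d\hat{\boldsymbol\theta}_j(\mathbf y)+\hat\theta_0(\mathbf y)\mathbf 1$. For $j=1,\dots,d$ let $Q_0^j$ be the submatrix of $Q_j$ consisting of those rows $\mathbf q_{ji}^\top$ ($1\le i\le n_j$) such that $\mathbf q_{ji}^\top\hat{\boldsymbol\theta}_j(\mathbf y)=0$, let $K_j=\begin{pmatrix}Q_0^j\\ \mathbf 1_{1\times n}\end{pmatrix}$, and let $\ker(K_j)=\{\mathbf x\in\mathbb{R}^n: Q_0^j\mathbf x=\mathbf 0\text{ and }\mathbf 1_{1\times n}\mathbf x=0\}$. Then, for almost every $\mathbf y\in\mathbb{R}^n$, the divergence of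 $\hat{\boldsymbol\theta}(\mathbf y)$ is $$D(\mathbf y)=\dim\big(\mathrm{span}\{\mathbf 1_{n\times1},\ker(K_1),\dots,\ker(K_d)\}\big),$$ and $\mathrm{df}(\hat{\boldsymbol\theta}(\mathbf y))=\mathbb{E}[D(\mathbf y)]$.
   Context: $\mathbf 1$ is the all-ones vector in $\mathbb{R}^n$ and $\mathbf 1_{a\times b}$ the all-ones $a\times b$ matrix. Given design points $\mathbf x_i=(x_{i1},\dots,x_{id})$, $i=1,\dots,n$, one has $Q_j=D_jP_j$, where $P_j\in\mathbb{R}^{n\times n}$ is the permutation matrix that orders the $j$-th feature from least to greatest and $D_j\in\mathbb{R}^{n_j\times n}$ is a given discrete difference matrix of some order, possibly depending on $j$ (for instance, for first order, $n_j=n-1$ and the $i$-th row of $D_j$ has only two nonzero entries, $1$ in position $i$ and $-1$ in position $i+1$). The divergence is $D(\mathbf y):=\sum_{i=1}^n\frac{\partial}{\partial y_i}\hat\theta_i(\mathbf y)$ where $\hat\theta_i(\mathbf y)$ are the entries of the fitted vector $\hat{\boldsymbol\theta}(\mathbf y)$ (which is unique). For the degrees of freedom, $\mathbf y=\boldsymbol\theta^*+\boldsymbol\epsilon$ with $\boldsymbol\theta^*\in\mathbb{R}^n$ fixed, $\boldsymbol\epsilon\sim N(\mathbf 0,\sigma^2I_n)$, $\sigma>0$, and $\mathrm{df}(\hat{\boldsymbol\theta}(\mathbf y)):=\frac1{\sigma^2}\sum_{i=1}^n\mathrm{Cov}(\hat\theta_i(\mathbf y),y_i)$. *)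

theory Defs
  imports "HOL-Probability.Probability"
begin

text \<open>
  Observations are indexed by the finite type \<open>'n\<close>, so \<open>n = CARD('n)\<close>, and features by the finite
  type \<open>'d\<close>, so \<open>d = CARD('d)\<close>; \<open>(1 :: real^'n)\<close> is the all-ones vector.  Positions in a sorted
  order are the natural numbers below \<open>n\<close>, and rows of all matrices are counted from 0.  A
  matrix whose number of rows is not a type is a function of row and column, of which only the
  entries inside the stated dimensions are used.
\<close>

text \<open>
  Discrete difference matrices of order \<open>k\<close>, with \<open>n - k\<close> rows and \<open>n\<close> columns.  The passage from
  order \<open>k\<close> to order \<open>k + 1\<close> is \<open>D' = D1 * diag w * D\<close>, where \<open>D1\<close> is the first order difference
  matrix with \<open>n - k - 1\<close> rows and \<open>n - k\<close> columns.  Weights \<open>w = 1\<close> give the iterated differences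
  used for equally spaced points; \<open>w l = k / (x (l + k) - x l)\<close>, for distinct sorted points \<open>x\<close>,
  gives the trend filtering difference matrices for arbitrarily spaced points.
\<close>

inductive difference_matrix :: "nat \<Rightarrow> nat \<Rightarrow> (nat \<Rightarrow> nat \<Rightarrow> real) \<Rightarrow> bool" for n :: nat where
  first_order:
    "difference_matrix n 1 (\<lambda>r a. if a = r then 1 else if a = r + 1 then - 1 else 0)"
| next_order:
    "difference_matrix n k D \<Longrightarrow> (\<And>l. l < n - k \<Longrightarrow> w l > 0) \<Longrightarrow>
     difference_matrix n (Suc k) (\<lambda>r a. w r * D r a - w (r + 1) * D (r + 1) a)"

text \<open>
  \<open>P\<close> is the permutation matrix with \<open>(P *v v)\<^sub>a = v (s a)\<close>, where \<open>s\<close> lists the observations so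
  that the feature values \<open>z\<close> are nondecreasing.  With ties any such listing is admitted.
\<close>

definition sorting_permutation_matrix :: "('n::finite \<Rightarrow> real) \<Rightarrow> (nat \<Rightarrow> 'n \<Rightarrow> real) \<Rightarrow> bool" where
  "sorting_permutation_matrix z P \<longleftrightarrow>
     (\<exists>s. bij_betw s {..<CARD('n)} (UNIV :: 'n set) \<and>
          (\<forall>a b. a \<le> b \<longrightarrow> b < CARD('n) \<longrightarrow> z (s a) \<le> z (s b)) \<and>
          (\<forall>a < CARD('n). \<forall>i. P a i = (if i = s a then 1 else 0)))"

definition matrix_product_row ::
    "(nat \<Rightarrow> nat \<Rightarrow> real) \<Rightarrow> (nat \<Rightarrow> 'n::finite \<Rightarrow> real) \<Rightarrow> nat \<Rightarrow> real^'n" where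
  "matrix_product_row D P r = (\<chi> i. \<Sum>a<CARD('n). D r a * P a i)"

text \<open>Below, \<open>q j r\<close> is row \<open>r\<close> of \<open>Q\<^sub>j\<close>, and \<open>m j\<close> is its number of rows.\<close>

definition gtv_objective ::
    "real \<Rightarrow> ('d::finite \<Rightarrow> nat) \<Rightarrow> ('d \<Rightarrow> nat \<Rightarrow> real^'n) \<Rightarrow> real^'n \<Rightarrow> real \<Rightarrow> ('d \<Rightarrow> real^'n) \<Rightarrow> real"
    where
  "gtv_objective \<tau> m q y \<theta>0 \<theta> =
     1 / 2 * (norm (y - (\<Sum>j\<in>UNIV. \<theta> j) - \<theta>0 *\<^sub>R 1))\<^sup>2 + \<tau> * (\<Sum>j\<in>UNIV. \<Sum>r<m j. \<bar>q j r \<bullet> \<theta> j\<bar>)"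

definition gtv_feasible :: "('d::finite \<Rightarrow> real^'n) \<Rightarrow> bool" where
  "gtv_feasible \<theta> \<longleftrightarrow> (\<forall>j. 1 \<bullet> \<theta> j = 0)"

definition gtv_solution ::
    "real \<Rightarrow> ('d::finite \<Rightarrow> nat) \<Rightarrow> ('d \<Rightarrow> nat \<Rightarrow> real^'n) \<Rightarrow> real^'n \<Rightarrow> real \<Rightarrow> ('d \<Rightarrow> real^'n) \<Rightarrow> bool"
    where
  "gtv_solution \<tau> m q y \<theta>0 \<theta> \<longleftrightarrow> gtv_feasible \<theta> \<and>
     (\<forall>\<phi>0 \<phi>. gtv_feasible \<phi> \<longrightarrow> gtv_objective \<tau> m q y \<theta>0 \<theta> \<le> gtv_objective \<tau> m q y \<phi>0 \<phi>)"

text \<open>The kernel of \<open>K\<^sub>j\<close>, where \<open>m\<close>, \<open>q\<close>, \<open>\<theta>\<close> are the data for one component \<open>j\<close>.\<close>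

definition ker_K :: "nat \<Rightarrow> (nat \<Rightarrow> real^'n) \<Rightarrow> real^'n \<Rightarrow> (real^'n) set" where
  "ker_K m q \<theta> = {x. (\<forall>r<m. q r \<bullet> \<theta> = 0 \<longrightarrow> q r \<bullet> x = 0) \<and> 1 \<bullet> x = 0}"

definition has_diagonal_partials :: "(real^'n \<Rightarrow> real^'n) \<Rightarrow> real^'n \<Rightarrow> bool" where
  "has_diagonal_partials f y \<longleftrightarrow>
     (\<forall>i. (\<lambda>t. f (y + t *\<^sub>R axis i 1) $ i) field_differentiable (at 0))"

definition divergence :: "(real^'n \<Rightarrow> real^'n) \<Rightarrow> real^'n \<Rightarrow> real" where
  "divergence f y = (\<Sum>i\<in>UNIV. deriv (\<lambda>t. f (y + t *\<^sub>R axis i 1) $ i) 0)"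

text \<open>The density of \<open>N(0, \<sigma>\<^sup>2 I\<^sub>n)\<close> with respect to Lebesgue measure.\<close>

definition isotropic_normal_density :: "real \<Rightarrow> real^'n \<Rightarrow> real" where
  "isotropic_normal_density \<sigma> e = (\<Prod>i\<in>UNIV. normal_density 0 \<sigma> (e $ i))"

definition has_covariance :: "'a measure \<Rightarrow> ('a \<Rightarrow> real) \<Rightarrow> ('a \<Rightarrow> real) \<Rightarrow> bool" where
  "has_covariance M X Y \<longleftrightarrow> integrable M X \<and> integrable M Y \<and> integrable M (\<lambda>\<omega>. X \<omega> * Y \<omega>)"

definition covariance :: "'a measure \<Rightarrow> ('a \<Rightarrow> real) \<Rightarrow> ('a \<Rightarrow> real) \<Rightarrow> real" where
  "covariance M X Y =
     integral\<^sup>L M (\<lambda>\<omega>. (X \<omega> - integral\<^sup>L M X) * (Y \<omega> - integral\<^sup>L M Y))"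

definition degrees_of_freedom ::
    "'a measure \<Rightarrow> real \<Rightarrow> ('a \<Rightarrow> real^'n) \<Rightarrow> (real^'n \<Rightarrow> real^'n) \<Rightarrow> real" where
  "degrees_of_freedom M \<sigma> Y f =
     1 / \<sigma>\<^sup>2 * (\<Sum>i\<in>UNIV. covariance M (\<lambda>\<omega>. f (Y \<omega>) $ i) (\<lambda>\<omega>. Y \<omega> $ i))"

end

theory Submission
  imports Defs
begin

text \<open>
  Write \<open>W y\<close> for the span of \<open>1\<close> and the kernels \<open>ker_K\<close> of a solution at \<open>y\<close>.  The theorem rests
  on two facts about the fitted vector.

  First, \<open>fit\<close> is a continuous selection from finitely many affine maps.  Continuity holds
  because \<open>fit\<close> is nonexpansive, as proximal maps of convex functions are
  (\<open>fitted_vector_nonexpansive\<close>).  For the affine maps, take the signs of all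
  penalty terms of the solution at \<open>y\<close>.  Directions that keep the vanishing terms at zero can be
  followed both ways, so the first order condition is an equation along them: the
  inner products of \<open>y - fit y\<close> with vectors of \<open>W y\<close> depend on the signs only
  (\<open>residual_inner_of_pattern_direction\<close>).  Since \<open>fit y\<close> lies in \<open>W y\<close>, it is the orthogonal
  projection of \<open>y\<close> to \<open>W y\<close> plus a constant given by the signs, and there are finitely many
  sign patterns.  Two distinct affine maps agree on a null set only, so that almost every \<open>y\<close> has
  a neighbourhood on which \<open>fit\<close> is a single one of these maps
  (\<open>AE_continuous_selection_locally_affine\<close>).  Its divergence is then the trace of a
  projection, namely the dimension of \<open>W y\<close>.  Solutions need not be unique, and the argument
  is indifferent to which one is chosen at each \<open>y\<close>.

  Second, Stein's identity \<open>E[f\<^sub>i(Y) \<epsilon>\<^sub>i] = \<sigma>\<^sup>2 E[\<partial>\<^sub>i f\<^sub>i(Y)]\<close> holds for Lipschitz functions that have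
  their partial derivatives almost everywhere (\<open>stein_identity\<close>), by differentiating
  the expectation of a translate of the function, where the translation can be moved to the
  Gaussian density.  Summed over the coordinates, it turns covariances into the divergence.
\<close>

section \<open>Optimality of solutions\<close>

text \<open>
  Moving from the solution towards a feasible competitor by a fraction \<open>t\<close> changes the
  penalty by at most \<open>t\<close> times its total change, by convexity, and the quadratic term by its
  linear part plus \<open>O(t\<^sup>2)\<close>; optimality and \<open>t \<rightarrow> 0\<close> leave the inequality of the linear parts.
\<close>

lemma solution_variational_inequality:
  fixes y :: "real^'n" and \<theta> \<phi> :: "'d::finite \<Rightarrow> real^'n"
  assumes sol: "gtv_solution \<tau> m q y \<theta>0 \<theta>" and "gtv_feasible \<phi>" and "\<tau> > 0"
  shows "(y - (\<Sum>j\<in>UNIV. \<theta> j) - \<theta>0 *\<^sub>R 1) \<bullet>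
           (((\<Sum>j\<in>UNIV. \<phi> j) + \<phi>0 *\<^sub>R 1) - ((\<Sum>j\<in>UNIV. \<theta> j) + \<theta>0 *\<^sub>R 1))
         \<le> \<tau> * (\<Sum>j\<in>UNIV. \<Sum>r<m j. \<bar>q j r \<bullet> \<phi> j\<bar>) - \<tau> * (\<Sum>j\<in>UNIV. \<Sum>r<m j. \<bar>q j r \<bullet> \<theta> j\<bar>)"
    (is "?u \<bullet> ?d \<le> ?p \<phi> - ?p \<theta>")
proof -
  have step: "?u \<bullet> ?d \<le> ?p \<phi> - ?p \<theta> + t / 2 * (norm ?d)\<^sup>2" if t: "0 < t" "t \<le> 1" for t
  proof -
    define \<psi> where "\<psi> = (\<lambda>j. \<theta> j + t *\<^sub>R (\<phi> j - \<theta> j))"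
    define \<psi>0 where "\<psi>0 = \<theta>0 + t * (\<phi>0 - \<theta>0)"
    have "gtv_feasible \<psi>"
      using assms by (simp add: gtv_feasible_def gtv_solution_def \<psi>_def inner_add_right inner_diff_right)
    then have le: "gtv_objective \<tau> m q y \<theta>0 \<theta> \<le> gtv_objective \<tau> m q y \<psi>0 \<psi>"
      using sol by (simp add: gtv_solution_def)
    have abs: "\<bar>q j r \<bullet> \<psi> j\<bar> \<le> (1 - t) * \<bar>q j r \<bullet> \<theta> j\<bar> + t * \<bar>q j r \<bullet> \<phi> j\<bar>" for j r
    proof -
      have "q j r \<bullet> \<psi> j = (1 - t) * (q j r \<bullet> \<theta> j) + t * (q j r \<bullet> \<phi> j)"
        by (simp add: \<psi>_def algebra_simps inner_add_right inner_diff_right)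
      then show ?thesis
        using t abs_triangle_ineq[of "(1 - t) * (q j r \<bullet> \<theta> j)" "t * (q j r \<bullet> \<phi> j)"]
        by (simp add: abs_mult)
    qed
    have "?p \<psi> \<le> \<tau> * (\<Sum>j\<in>UNIV. \<Sum>r<m j. (1 - t) * \<bar>q j r \<bullet> \<theta> j\<bar> + t * \<bar>q j r \<bullet> \<phi> j\<bar>)"
      using \<open>\<tau> > 0\<close> by (intro mult_left_mono sum_mono abs) auto
    also have "\<dots> = (1 - t) * ?p \<theta> + t * ?p \<phi>"
      by (simp only: sum.distrib sum_distrib_left [symmetric]) (simp add: algebra_simps)
    finally have pen: "?p \<psi> \<le> (1 - t) * ?p \<theta> + t * ?p \<phi>" .
    have "(\<Sum>j\<in>UNIV. \<psi> j) = (\<Sum>j\<in>UNIV. \<theta> j) + t *\<^sub>R ((\<Sum>j\<in>UNIV. \<phi> j) - (\<Sum>j\<in>UNIV. \<theta> j))"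
      by (simp only: \<psi>_def sum.distrib sum_subtractf [symmetric] scaleR_right.sum)
    then have "y - (\<Sum>j\<in>UNIV. \<psi> j) - \<psi>0 *\<^sub>R 1 = ?u - t *\<^sub>R ?d"
      by (simp add: \<psi>0_def algebra_simps)
    moreover have "(norm (u - t *\<^sub>R v))\<^sup>2 = (norm u)\<^sup>2 - 2 * t * (u \<bullet> v) + t\<^sup>2 * (norm v)\<^sup>2" for u v :: "real^'n"
      unfolding power2_norm_eq_inner
      by (simp add: inner_diff_left inner_diff_right inner_commute power2_eq_square)
    ultimately have sq: "(norm (y - (\<Sum>j\<in>UNIV. \<psi> j) - \<psi>0 *\<^sub>R 1))\<^sup>2
        = (norm ?u)\<^sup>2 - 2 * t * (?u \<bullet> ?d) + t\<^sup>2 * (norm ?d)\<^sup>2"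
      by (simp only:)
    have arith: "1 / 2 * a + p \<le> 1 / 2 * b + p' \<Longrightarrow> b = a - 2 * t * w + t\<^sup>2 * n \<Longrightarrow>
        p' \<le> (1 - t) * p + t * p'' \<Longrightarrow> t * w \<le> t * (p'' - p + t / 2 * n)" for a b p p' p'' w n :: real
      by (simp add: algebra_simps power2_eq_square)
    have "t * (?u \<bullet> ?d) \<le> t * (?p \<phi> - ?p \<theta> + t / 2 * (norm ?d)\<^sup>2)"
      by (rule arith[OF le[unfolded gtv_objective_def] sq pen])
    then show ?thesis using t by simp
  qed
  show ?thesis
  proof (rule tendsto_lowerbound)
    show "((\<lambda>t. ?p \<phi> - ?p \<theta> + t / 2 * (norm ?d)\<^sup>2) \<longlongrightarrow> ?p \<phi> - ?p \<theta>) (at_right 0)"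
      by (auto intro!: tendsto_eq_intros)
    show "\<forall>\<^sub>F t in at_right 0. ?u \<bullet> ?d \<le> ?p \<phi> - ?p \<theta> + t / 2 * (norm ?d)\<^sup>2"
      by (rule eventually_at_rightI[of 0 1]) (use step in auto)
  qed simp
qed

text \<open>
  Two variational inequalities, each with the other solution as competitor, add up to
  monotonicity of the residual, and Cauchy-Schwarz does the rest.  For \<open>y = y'\<close> this is uniqueness
  of the fitted vector, although the components of a solution need not be unique.
\<close>

lemma fitted_vector_nonexpansive:
  assumes sol: "gtv_solution \<tau> m q y \<theta>0 \<theta>" and sol': "gtv_solution \<tau> m q y' \<theta>0' \<theta>'" and "\<tau> > 0"
  shows "dist ((\<Sum>j\<in>UNIV. \<theta> j) + \<theta>0 *\<^sub>R 1) ((\<Sum>j\<in>UNIV. \<theta>' j) + \<theta>0' *\<^sub>R 1) \<le> dist y y'"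
    (is "dist ?f ?f' \<le> _")
proof -
  have "gtv_feasible \<theta>" "gtv_feasible \<theta>'"
    using sol sol' by (auto simp: gtv_solution_def)
  then have "(y - ?f) \<bullet> (?f' - ?f) + (y' - ?f') \<bullet> (?f - ?f') \<le> 0"
    using solution_variational_inequality[OF sol, of \<theta>' \<theta>0'] solution_variational_inequality[OF sol', of \<theta> \<theta>0] \<open>\<tau> > 0\<close>
    by (simp add: diff_diff_eq)
  moreover have "dist f f' \<le> dist y y'" if "(y - f) \<bullet> (f' - f) + (y' - f') \<bullet> (f - f') \<le> 0" for f f'
  proof -
    have "norm (f - f') * norm (f - f') = (f - f') \<bullet> (f - f')"
      by (simp add: dot_square_norm power2_eq_square)
    also have "\<dots> \<le> (y - y') \<bullet> (f - f')"
      using that by (simp add: inner_diff_left inner_diff_right inner_commute)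
    also have "\<dots> \<le> norm (y - y') * norm (f - f')"
      by (rule norm_cauchy_schwarz)
    finally show ?thesis
      unfolding dist_norm by (cases "f = f'") simp_all
  qed
  ultimately show ?thesis by blast
qed

lemma abs_add_small_multiple:
  fixes a c :: real
  assumes "a = 0 \<Longrightarrow> c = 0"
  shows "\<forall>\<^sub>F t in nhds 0. \<bar>a + t * c\<bar> = \<bar>a\<bar> + t * (sgn a * c)"
proof (cases "a = 0")
  case False
  have "((\<lambda>t. (a + t * c) * sgn a) \<longlongrightarrow> (a + 0 * c) * sgn a) (nhds 0)"
    by (intro tendsto_intros filterlim_ident)
  moreover have "(a + 0 * c) * sgn a > 0"
    using False by (simp add: sgn_real_def)
  ultimately have "\<forall>\<^sub>F t in nhds 0. (a + t * c) * sgn a > 0"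
    by (rule order_tendstoD)
  then show ?thesis
    by eventually_elim (use False in \<open>auto simp: sgn_real_def abs_if algebra_simps split: if_splits\<close>)
qed (use assms in simp)

text \<open>
  Along directions that keep the vanishing penalty terms at zero, the penalty is linear near
  the solution, so the variational inequality holds for a small positive and a small negative
  step and becomes an equation.  For a given direction, the right-hand side depends on \<open>y\<close> only
  through the signs of the penalty terms.
\<close>

lemma residual_inner_of_pattern_direction:
  fixes \<theta> b :: "'d::finite \<Rightarrow> real^'n::finite"
  assumes sol: "gtv_solution \<tau> m q y \<theta>0 \<theta>" and "\<tau> > 0"
    and b: "\<And>j. b j \<in> ker_K (m j) (q j) (\<theta> j)"
  shows "(y - ((\<Sum>j\<in>UNIV. \<theta> j) + \<theta>0 *\<^sub>R 1)) \<bullet> ((\<Sum>j\<in>UNIV. b j) + b0 *\<^sub>R 1)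
         = \<tau> * (\<Sum>j\<in>UNIV. \<Sum>r<m j. sgn (q j r \<bullet> \<theta> j) * (q j r \<bullet> b j))"
    (is "?u \<bullet> ?w = ?c")
proof -
  have "\<forall>\<^sub>F t in nhds 0. \<forall>j\<in>UNIV. \<forall>r\<in>{..<m j}.
      \<bar>q j r \<bullet> \<theta> j + t * (q j r \<bullet> b j)\<bar> = \<bar>q j r \<bullet> \<theta> j\<bar> + t * (sgn (q j r \<bullet> \<theta> j) * (q j r \<bullet> b j))"
    using b by (intro eventually_ball_finite ballI abs_add_small_multiple) (auto simp: ker_K_def)
  then obtain e where "e > 0" and e: "\<And>t j r. \<bar>t\<bar> < e \<Longrightarrow> r < m j \<Longrightarrow>
      \<bar>q j r \<bullet> \<theta> j + t * (q j r \<bullet> b j)\<bar> = \<bar>q j r \<bullet> \<theta> j\<bar> + t * (sgn (q j r \<bullet> \<theta> j) * (q j r \<bullet> b j))"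
    unfolding eventually_nhds_metric by (auto simp: dist_real_def)
  have ineq: "t * (?u \<bullet> ?w) \<le> t * ?c" if "\<bar>t\<bar> < e" for t
  proof -
    have "gtv_feasible (\<lambda>j. \<theta> j + t *\<^sub>R b j)"
      using sol b by (auto simp: gtv_solution_def gtv_feasible_def ker_K_def inner_add_right)
    moreover have "((\<Sum>j\<in>UNIV. \<theta> j + t *\<^sub>R b j) + (\<theta>0 + t * b0) *\<^sub>R 1)
        - ((\<Sum>j\<in>UNIV. \<theta> j) + \<theta>0 *\<^sub>R 1) = t *\<^sub>R ?w"
      by (simp only: sum.distrib scaleR_add_left scaleR_add_right scaleR_right.sum scaleR_scaleR)
         (simp add: algebra_simps)
    ultimately have "?u \<bullet> (t *\<^sub>R ?w) \<le> \<tau> * (\<Sum>j\<in>UNIV. \<Sum>r<m j. \<bar>q j r \<bullet> \<theta> j + t * (q j r \<bullet> b j)\<bar>)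
        - \<tau> * (\<Sum>j\<in>UNIV. \<Sum>r<m j. \<bar>q j r \<bullet> \<theta> j\<bar>)"
      using solution_variational_inequality[OF sol _ \<open>\<tau> > 0\<close>, of "\<lambda>j. \<theta> j + t *\<^sub>R b j" "\<theta>0 + t * b0"]
      by (simp only: diff_diff_eq inner_add_right inner_scaleR_right)
    also have "(\<Sum>j\<in>UNIV. \<Sum>r<m j. \<bar>q j r \<bullet> \<theta> j + t * (q j r \<bullet> b j)\<bar>)
        = (\<Sum>j\<in>UNIV. \<Sum>r<m j. \<bar>q j r \<bullet> \<theta> j\<bar>) + t * (\<Sum>j\<in>UNIV. \<Sum>r<m j. sgn (q j r \<bullet> \<theta> j) * (q j r \<bullet> b j))"
      unfolding sum_distrib_left sum.distrib [symmetric] using that by (intro sum.cong refl e) auto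
    finally have "?u \<bullet> (t *\<^sub>R ?w) \<le> t * ?c" by (simp only: algebra_simps)
    then show ?thesis by (simp only: inner_scaleR_right)
  qed
  from ineq[of "e/2"] ineq[of "-e/2"] \<open>e > 0\<close> show ?thesis by simp
qed


section \<open>Orthogonal projections and their trace\<close>

definition is_orthogonal_projection :: "'a::euclidean_space set \<Rightarrow> ('a \<Rightarrow> 'a) \<Rightarrow> bool" where
  "is_orthogonal_projection W L \<longleftrightarrow>
     linear L \<and> (\<forall>y. L y \<in> W) \<and> (\<forall>y. \<forall>w\<in>W. (y - L y) \<bullet> w = 0)"

text \<open>
  In an orthonormal basis \<open>B\<close> of \<open>W\<close>, the projection is \<open>\<Sum>b\<in>B. (y \<bullet> b) b\<close>, and its trace is the
  sum of the squared norms of the basis vectors.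
\<close>

lemma ex_orthogonal_projection:
  fixes W :: "(real^'n) set"
  assumes "subspace W"
  shows "\<exists>L. is_orthogonal_projection W L \<and> (\<Sum>i\<in>UNIV. L (axis i 1) $ i) = real (dim W)"
proof -
  obtain B where B: "B \<subseteq> W" "pairwise orthogonal B" "\<And>x. x \<in> B \<Longrightarrow> norm x = 1"
    "independent B" "card B = dim W" "span B = W"
    using orthonormal_basis_subspace[OF assms] by metis
  have "finite B" using B(4) by (rule independent_imp_finite)
  define L where "L y = (\<Sum>b\<in>B. (y \<bullet> b) *\<^sub>R b)" for y
  have "linear L"
    unfolding L_def by (rule linearI) (auto simp: inner_add_left scaleR_add_left sum.distrib scaleR_right.sum)
  moreover have "L y \<in> W" for y
    unfolding L_def using B(1) assms by (auto intro!: subspace_sum subspace_scale)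
  moreover have "(y - L y) \<bullet> w = 0" if "w \<in> W" for y w
  proof -
    have "B \<subseteq> {w. (y - L y) \<bullet> w = 0}"
    proof
      fix b assume b: "b \<in> B"
      have "L y \<bullet> b = (\<Sum>c\<in>B. (y \<bullet> c) * (c \<bullet> b))"
        by (simp add: L_def inner_sum_left)
      also have "\<dots> = (\<Sum>c\<in>B. if c = b then y \<bullet> b else 0)"
        using B(2,3) b by (intro sum.cong) (auto simp: pairwise_def orthogonal_def norm_eq_1)
      finally show "b \<in> {w. (y - L y) \<bullet> w = 0}"
        using b \<open>finite B\<close> by (simp add: inner_diff_left)
    qed
    moreover have "subspace {w. (y - L y) \<bullet> w = 0}"
      by (rule subspace_hyperplane)
    ultimately have "span B \<subseteq> {w. (y - L y) \<bullet> w = 0}"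
      by (rule span_minimal)
    then show ?thesis using that B(6) by auto
  qed
  moreover have "(\<Sum>i\<in>UNIV. L (axis i 1) $ i) = real (dim W)"
  proof -
    have "(\<Sum>i\<in>UNIV. L (axis i 1) $ i) = (\<Sum>i\<in>UNIV. \<Sum>b\<in>B. b $ i * b $ i)"
      by (simp add: L_def inner_axis')
    also have "\<dots> = (\<Sum>b\<in>B. \<Sum>i\<in>UNIV. b $ i * b $ i)"
      by (rule sum.swap)
    also have "\<dots> = (\<Sum>b\<in>B. b \<bullet> b)"
      by (simp add: inner_vec_def)
    also have "\<dots> = real (dim W)"
      using B(3,5) by (simp add: norm_eq_1)
    finally show ?thesis .
  qed
  ultimately show ?thesis unfolding is_orthogonal_projection_def by blast
qed

lemma orthogonal_projection_unique:
  assumes "subspace W" and L: "is_orthogonal_projection W L"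
    and "v \<in> W" and v: "\<And>w. w \<in> W \<Longrightarrow> (y - v) \<bullet> w = 0"
  shows "L y = v"
proof -
  have "L y - v \<in> W"
    using L \<open>subspace W\<close> \<open>v \<in> W\<close> by (simp add: is_orthogonal_projection_def subspace_diff)
  then have "(y - v) \<bullet> (L y - v) - (y - L y) \<bullet> (L y - v) = 0"
    using L v by (simp add: is_orthogonal_projection_def)
  then have "(L y - v) \<bullet> (L y - v) = 0"
    by (simp add: inner_diff_left)
  then show ?thesis by simp
qed


section \<open>Continuous selections of affine maps\<close>

lemma negligible_coincidence_of_affine_maps:
  fixes L L' :: "'a::euclidean_space \<Rightarrow> 'b::euclidean_space"
  assumes "linear L" "linear L'" and neq: "(\<lambda>z. L z + c) \<noteq> (\<lambda>z. L' z + c')"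
  shows "negligible {z. L z + c = L' z + c'}"
proof -
  define A where "A z = L z - L' z" for z
  have "linear A"
    unfolding A_def using assms(1,2) by (rule linear_compose_sub)
  obtain z0 where "A z0 + (c - c') \<noteq> 0"
    using neq by (auto simp: A_def fun_eq_iff algebra_simps)
  then obtain b where b: "b \<in> Basis" "(A z0 + (c - c')) \<bullet> b \<noteq> 0"
    using euclidean_all_zero_iff by blast
  have eq: "(A z + (c - c')) \<bullet> b = adjoint A b \<bullet> z + (c - c') \<bullet> b" for z
    using adjoint_works[OF \<open>linear A\<close>, of z b] by (metis inner_add_left inner_commute)
  have "adjoint A b \<noteq> 0 \<or> - ((c - c') \<bullet> b) \<noteq> 0"
    using b(2) unfolding eq by auto
  then have "negligible {z. adjoint A b \<bullet> z = - ((c - c') \<bullet> b)}"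
    by (rule negligible_hyperplane)
  moreover have "{z. L z + c = L' z + c'} \<subseteq> {z. adjoint A b \<bullet> z = - ((c - c') \<bullet> b)}"
  proof
    fix z assume "z \<in> {z. L z + c = L' z + c'}"
    then have "A z + (c - c') = 0" by (simp add: A_def algebra_simps)
    then have "(A z + (c - c')) \<bullet> b = 0" by simp
    then show "z \<in> {z. adjoint A b \<bullet> z = - ((c - c') \<bullet> b)}"
      unfolding eq by simp
  qed
  ultimately show ?thesis by (rule negligible_subset)
qed

text \<open>
  Off a null set, distinct maps of \<open>\<A>\<close> take distinct values at \<open>y\<close>, so \<open>f y\<close> equals the value of
  only one of them.  By continuity the others stay different from \<open>f\<close> near \<open>y\<close>, and the selection
  has no choice left there.
\<close>

lemma AE_continuous_selection_locally_affine:
  fixes f :: "'a::euclidean_space \<Rightarrow> 'b::euclidean_space"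
  assumes cont: "continuous_on UNIV f" and fin: "finite \<A>"
    and aff: "\<And>g. g \<in> \<A> \<Longrightarrow> \<exists>L c. linear L \<and> g = (\<lambda>z. L z + c)"
    and sel: "\<And>y. \<exists>g\<in>\<A>. f y = g y"
  shows "AE y in lebesgue. \<forall>g\<in>\<A>. f y = g y \<longrightarrow> (\<forall>\<^sub>F z in nhds y. f z = g z)"
proof -
  define N where "N = (\<Union>(g, h)\<in>{(g, h). g \<in> \<A> \<and> h \<in> \<A> \<and> g \<noteq> h}. {z. g z = h z})"
  have "finite {(g, h). g \<in> \<A> \<and> h \<in> \<A> \<and> g \<noteq> h}"
    by (rule finite_subset[of _ "\<A> \<times> \<A>"]) (use fin in auto)
  moreover have "negligible {z. g z = h z}" if "g \<in> \<A>" "h \<in> \<A>" "g \<noteq> h" for g h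
  proof -
    obtain L c L' c' where "linear L" "g = (\<lambda>z. L z + c)" "linear L'" "h = (\<lambda>z. L' z + c')"
      using aff \<open>g \<in> \<A>\<close> \<open>h \<in> \<A>\<close> by metis
    then show ?thesis
      using negligible_coincidence_of_affine_maps[of L L' c c'] \<open>g \<noteq> h\<close> by simp
  qed
  ultimately have "negligible N"
    unfolding N_def by (intro negligible_Union) auto
  have "\<forall>g\<in>\<A>. f y = g y \<longrightarrow> (\<forall>\<^sub>F z in nhds y. f z = g z)" if y: "y \<notin> N" for y
  proof (intro ballI impI)
    fix g assume g: "g \<in> \<A>" "f y = g y"
    have "\<forall>\<^sub>F z in nhds y. \<forall>h\<in>\<A> - {g}. f z \<noteq> h z"
    proof (intro eventually_ball_finite ballI)
      fix h assume h: "h \<in> \<A> - {g}"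
      then obtain L c where L: "linear L" "h = (\<lambda>z. L z + c)" using aff by blast
      have "f y \<noteq> h y" using g h y by (auto simp: N_def)
      have "open {z. f z \<noteq> h z}"
        unfolding L(2) using cont linear_continuous_on_compose[OF continuous_on_id L(1)]
        by (intro open_Collect_neq continuous_intros) auto
      then show "\<forall>\<^sub>F z in nhds y. f z \<noteq> h z"
        using \<open>f y \<noteq> h y\<close> eventually_nhds by blast
    qed (use fin in auto)
    then show "\<forall>\<^sub>F z in nhds y. f z = g z"
      by eventually_elim (use sel in blast)
  qed
  then show ?thesis
    using \<open>negligible N\<close> by (auto simp: negligible_iff_null_sets intro: AE_I')
qed


section \<open>The fitted vector is locally affine almost everywhere\<close>

text \<open>
  The span in the theorem consists of the fitted vectors of the directions to which
  \<open>residual_inner_of_pattern_direction\<close> applies.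
\<close>

lemma pattern_span_decomposition:
  fixes \<theta> :: "'d::finite \<Rightarrow> real^'n::finite"
  assumes "w \<in> span ({1} \<union> (\<Union>j. ker_K (m j) (q j) (\<theta> j)))"
  shows "\<exists>b b0. (\<forall>j. b j \<in> ker_K (m j) (q j) (\<theta> j)) \<and> w = (\<Sum>j\<in>UNIV. b j) + b0 *\<^sub>R 1"
proof -
  let ?K = "\<lambda>j. ker_K (m j) (q j) (\<theta> j)"
  define T where "T = {(\<Sum>j\<in>UNIV. b j) + b0 *\<^sub>R 1 | b b0. \<forall>j. b j \<in> ?K j}"
  have K: "subspace (?K j)" for j
    by (auto simp: subspace_def ker_K_def inner_add_right)
  have "subspace T"
  proof (rule subspaceI)
    show "0 \<in> T"
      unfolding T_def using K by (auto intro!: exI[of _ "\<lambda>_. 0"] exI[of _ "0::real"] subspace_0)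
  next
    fix v w assume "v \<in> T" "w \<in> T"
    then obtain b b0 c c0 where "\<forall>j. b j \<in> ?K j" "v = (\<Sum>j\<in>UNIV. b j) + b0 *\<^sub>R 1"
      "\<forall>j. c j \<in> ?K j" "w = (\<Sum>j\<in>UNIV. c j) + c0 *\<^sub>R 1"
      unfolding T_def by blast
    then show "v + w \<in> T"
      unfolding T_def using K
      by (auto intro!: exI[of _ "\<lambda>j. b j + c j"] exI[of _ "b0 + c0"] subspace_add simp: sum.distrib scaleR_add_left)
  next
    fix s :: real and v assume "v \<in> T"
    then obtain b b0 where "\<forall>j. b j \<in> ?K j" "v = (\<Sum>j\<in>UNIV. b j) + b0 *\<^sub>R 1"
      unfolding T_def by blast
    then show "s *\<^sub>R v \<in> T"
      unfolding T_def using K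
      by (auto intro!: exI[of _ "\<lambda>j. s *\<^sub>R b j"] exI[of _ "s * b0"] subspace_scale simp: scaleR_add_right scaleR_right.sum)
  qed
  moreover have "1 \<in> T"
    unfolding T_def using K by (auto intro!: exI[of _ "\<lambda>_. 0"] exI[of _ "1::real"] subspace_0)
  moreover have "x \<in> T" if "x \<in> ?K j" for x j
    unfolding T_def using K that
    by (auto intro!: exI[of _ "\<lambda>i. if i = j then x else 0"] exI[of _ "0::real"] subspace_0)
  ultimately have "span ({1} \<union> (\<Union>j. ?K j)) \<subseteq> T"
    by (intro span_minimal) auto
  then show ?thesis using assms unfolding T_def by blast
qed

text \<open>
  A set of labelled signs rather than a function, so that finitely many patterns arise without a
  convention for rows outside the matrices.
\<close>

definition sign_pattern :: "('d::finite \<Rightarrow> nat) \<Rightarrow> ('d \<Rightarrow> nat \<Rightarrow> real^'n) \<Rightarrow> ('d \<Rightarrow> real^'n) \<Rightarrow> (('d \<times> nat) \<times> real) set" where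
  "sign_pattern m q \<theta> = (\<lambda>(j, r). ((j, r), sgn (q j r \<bullet> \<theta> j))) ` (SIGMA j:UNIV. {..<m j})"

lemma finite_range_sign_pattern: "finite (range (\<lambda>y. sign_pattern m q (\<theta> y)))"
proof (rule finite_subset)
  show "range (\<lambda>y. sign_pattern m q (\<theta> y)) \<subseteq> Pow ((SIGMA j:UNIV. {..<m j}) \<times> {-1, 0, 1})"
    by (auto simp: sign_pattern_def sgn_real_def split: if_splits)
qed auto

lemma sign_pattern_eqD:
  assumes "sign_pattern m q \<theta> = sign_pattern m q \<theta>'" and "r < m j"
  shows "sgn (q j r \<bullet> \<theta> j) = sgn (q j r \<bullet> \<theta>' j)"
proof -
  have "((j, r), sgn (q j r \<bullet> \<theta> j)) \<in> sign_pattern m q \<theta>'"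
    unfolding assms(1)[symmetric] using assms(2) by (force simp: sign_pattern_def)
  then show ?thesis by (auto simp: sign_pattern_def)
qed

text \<open>
  Let \<open>W y\<close> be the span in the statement.  It contains the fitted vector, and the inner products
  of the residual with vectors of \<open>W y\<close> are determined by the sign pattern of the chosen solution.
  So \<open>fit\<close> is the projection to \<open>W y\<close> plus a constant, where the subspace and the constant are
  functions of the pattern: it selects from finitely many affine maps.  The sets of
  \<open>y\<close> that have a given pattern depend on the choice of solutions and need not be measurable,
  so the null set is built from the finitely many maps instead.
\<close>

lemma AE_fit_locally_affine:
  fixes q :: "'d::finite \<Rightarrow> nat \<Rightarrow> real^'n::finite"
  assumes "\<tau> > 0" and sol: "\<And>y. gtv_solution \<tau> m q y (\<theta>0 y) (\<theta> y)"
    and fit: "\<And>y. fit y = (\<Sum>j\<in>UNIV. \<theta> y j) + \<theta>0 y *\<^sub>R 1"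
  shows "AE y in lebesgue. \<exists>L c. linear L \<and> (\<forall>\<^sub>F z in nhds y. fit z = L z + c) \<and>
           (\<Sum>i\<in>UNIV. L (axis i 1) $ i) = real (dim (span ({1} \<union> (\<Union>j. ker_K (m j) (q j) (\<theta> y j)))))"
proof -
  define W where "W y = span ({1} \<union> (\<Union>j. ker_K (m j) (q j) (\<theta> y j)))" for y
  define pat where "pat y = sign_pattern m q (\<theta> y)" for y
  have W: "subspace (W y)" for y by (simp add: W_def)
  define proj where "proj V = (SOME L. is_orthogonal_projection V L \<and>
      (\<Sum>i\<in>UNIV. L (axis i 1) $ i) = real (dim V))" for V :: "(real^'n) set"
  have projW: "is_orthogonal_projection (W y) (proj (W y))"
    and trace: "(\<Sum>i\<in>UNIV. proj (W y) (axis i 1) $ i) = real (dim (W y))" for y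
    using someI_ex[OF ex_orthogonal_projection[OF W[of y]]] by (simp_all add: proj_def)
  have lin: "linear (proj (W y))" for y
    using projW[of y] by (simp add: is_orthogonal_projection_def)
  have fit_W: "fit y \<in> W y" for y
  proof -
    have "\<theta> y j \<in> ker_K (m j) (q j) (\<theta> y j)" for j
      using sol[of y] by (auto simp: gtv_solution_def gtv_feasible_def ker_K_def)
    then show ?thesis
      unfolding fit W_def by (intro span_add span_sum span_scale span_base) auto
  qed
  have res: "(y - fit y) \<bullet> w = (y' - fit y') \<bullet> w \<and> W y = W y'" if pat: "pat y = pat y'" and w: "w \<in> W y" for y y' w
  proof
    note sgn = sign_pattern_eqD[OF pat[unfolded pat_def]]
    then have ker: "ker_K (m j) (q j) (\<theta> y j) = ker_K (m j) (q j) (\<theta> y' j)" for j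
      unfolding ker_K_def by (metis sgn_0_0)
    then show "W y = W y'" by (simp add: W_def)
    obtain b b0 where b: "\<And>j. b j \<in> ker_K (m j) (q j) (\<theta> y j)" and w: "w = (\<Sum>j\<in>UNIV. b j) + b0 *\<^sub>R 1"
      using pattern_span_decomposition[OF w[unfolded W_def]] by blast
    have b': "\<And>j. b j \<in> ker_K (m j) (q j) (\<theta> y' j)" using b ker by simp
    show "(y - fit y) \<bullet> w = (y' - fit y') \<bullet> w"
      unfolding fit w residual_inner_of_pattern_direction[OF sol \<open>\<tau> > 0\<close> b]
        residual_inner_of_pattern_direction[OF sol \<open>\<tau> > 0\<close> b']
      using sgn by simp
  qed
  \<comment> \<open>the affine map that represents \<open>fit\<close> at all points with the sign pattern of \<open>y\<close>\<close>
  define G where "G y = (\<lambda>z. proj (W y) z + (fit y - proj (W y) y))" for y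
  have G_eq: "G y = G y'" if pat: "pat y = pat y'" for y y'
  proof -
    have WW: "W y = W y'" using res[OF pat fit_W] by simp
    have "proj (W y) (y - y') = fit y - fit y'"
    proof (rule orthogonal_projection_unique[OF W projW])
      show "fit y - fit y' \<in> W y"
        using fit_W[of y] fit_W[of y'] W WW by (auto intro: subspace_diff)
      show "(y - y' - (fit y - fit y')) \<bullet> w = 0" if "w \<in> W y" for w
        using res[OF pat that] by (simp add: inner_diff_left)
    qed
    then have "fit y - proj (W y) y = fit y' - proj (W y) y'"
      using lin[of y] by (simp add: linear_diff algebra_simps)
    then show ?thesis by (simp add: G_def WW)
  qed
  have "range G \<subseteq> (\<lambda>p. G (SOME y. pat y = p)) ` range pat"
  proof
    fix g assume "g \<in> range G"
    then obtain y where y: "g = G y" by blast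
    have "pat (SOME y'. pat y' = pat y) = pat y" by (rule someI) simp
    then have "g = G (SOME y'. pat y' = pat y)"
      unfolding y by (intro G_eq) (rule sym)
    then show "g \<in> (\<lambda>p. G (SOME y. pat y = p)) ` range pat"
      by (rule image_eqI) (rule rangeI)
  qed
  then have "finite (range G)"
    using finite_range_sign_pattern[of m q \<theta>] by (auto simp: pat_def[abs_def] intro: finite_subset)
  moreover have "continuous_on UNIV fit"
    by (rule lipschitz_on_continuous_on[of 1])
       (auto simp: lipschitz_on_def fit intro: fitted_vector_nonexpansive[OF sol sol \<open>\<tau> > 0\<close>])
  moreover have "\<exists>L c. linear L \<and> g = (\<lambda>z. L z + c)" if "g \<in> range G" for g
    using that lin by (auto simp: G_def)
  moreover have self: "fit y = G y y" for y
    by (simp add: G_def)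
  ultimately have "AE y in lebesgue. \<forall>g\<in>range G. fit y = g y \<longrightarrow> (\<forall>\<^sub>F z in nhds y. fit z = g z)"
    by (intro AE_continuous_selection_locally_affine) auto
  then show ?thesis
  proof eventually_elim
    case (elim y)
    then have "\<forall>\<^sub>F z in nhds y. fit z = G y z" using self by blast
    then show ?case
      using lin[of y] trace[of y] unfolding G_def W_def[symmetric] by blast
  qed
qed


section \<open>Partial derivatives\<close>

lemma partials_of_locally_affine:
  assumes "linear L" and loc: "\<forall>\<^sub>F z in nhds y. f z = L z + c"
  shows "has_diagonal_partials f y" and "divergence f y = (\<Sum>i\<in>UNIV. L (axis i 1) $ i)"
proof -
  have D: "((\<lambda>t. f (y + t *\<^sub>R axis i 1) $ i) has_field_derivative L (axis i 1) $ i) (at 0)" for i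
  proof -
    have "((\<lambda>t. y + t *\<^sub>R axis i 1) \<longlongrightarrow> y) (nhds 0)"
      by (rule tendsto_eq_rhs[where x = "y + 0 *\<^sub>R axis i 1"]) (intro tendsto_intros filterlim_ident, simp)
    then have "\<forall>\<^sub>F t in nhds 0. f (y + t *\<^sub>R axis i 1) = L (y + t *\<^sub>R axis i 1) + c"
      using loc by (rule eventually_compose_filterlim[rotated])
    then have ev: "\<forall>\<^sub>F t in nhds 0. f (y + t *\<^sub>R axis i 1) $ i = L y $ i + t * L (axis i 1) $ i + c $ i"
      by eventually_elim (simp add: linear_add[OF \<open>linear L\<close>] linear_scale[OF \<open>linear L\<close>])
    have "((\<lambda>t. L y $ i + t * L (axis i 1) $ i + c $ i) has_field_derivative L (axis i 1) $ i) (at 0)"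
      by (auto intro!: derivative_eq_intros)
    then show ?thesis
      using DERIV_cong_ev[OF refl ev refl] by blast
  qed
  then show "has_diagonal_partials f y"
    by (auto simp: has_diagonal_partials_def field_differentiable_def)
  show "divergence f y = (\<Sum>i\<in>UNIV. L (axis i 1) $ i)"
    unfolding divergence_def by (intro sum.cong refl DERIV_imp_deriv D)
qed

text \<open>
  The derivative has to be Borel measurable as a total function, since it is composed with a
  random variable on a space that need not be complete; changing it on a null set is not an
  option.  Where the derivative exists, it is the limit \<open>R\<close> of a fixed sequence of
  difference quotients.  Existence, in turn, can be tested on rational increments by
  continuity, which makes the set \<open>E\<close> of differentiability Borel.  Off \<open>E\<close>, the constant
  \<open>deriv\<close> takes one and the same unspecified value.
\<close>

lemma borel_measurable_deriv_along:
  fixes g :: "'a::euclidean_space \<Rightarrow> real" and v :: 'a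
  assumes cont: "continuous_on UNIV g"
  shows "(\<lambda>y. deriv (\<lambda>t. g (y + t *\<^sub>R v)) 0) \<in> borel_measurable borel"
proof -
  have comp: "continuous_on S (\<lambda>z. g (h z))" if "continuous_on S h" for S :: "'b::topological_space set" and h
    using continuous_on_compose2[OF cont that] by simp
  define q where "q k y = (g (y + inverse (real (Suc k)) *\<^sub>R v) - g y) / inverse (real (Suc k))" for k y
  define R where "R y = lim (\<lambda>k. q k y)" for y
  define E where "E = {y. \<forall>n. \<exists>N. \<forall>t::rat. \<bar>real_of_rat t\<bar> < inverse (real (Suc N)) \<longrightarrow>
      \<bar>g (y + real_of_rat t *\<^sub>R v) - g y - R y * real_of_rat t\<bar> \<le> inverse (real (Suc n)) * \<bar>real_of_rat t\<bar>}"
  have g_meas: "(\<lambda>y. g (y + c)) \<in> borel_measurable borel" for c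
    by (intro borel_measurable_continuous_onI comp continuous_intros)
  note [measurable] = g_meas g_meas[of 0, simplified]
  have [measurable]: "q k \<in> borel_measurable borel" for k
    unfolding q_def by measurable
  have [measurable]: "R \<in> borel_measurable borel"
    unfolding R_def by measurable
  have [measurable]: "E \<in> sets borel"
    unfolding E_def by measurable
  have R: "R y = D" if "((\<lambda>t. g (y + t *\<^sub>R v)) has_field_derivative D) (at 0)" for y D
  proof -
    have "((\<lambda>t. (g (y + t *\<^sub>R v) - g y) / t) \<longlongrightarrow> D) (at 0)"
      using that by (simp add: has_field_derivative_iff)
    moreover have "filterlim (\<lambda>k. inverse (real (Suc k))) (at 0) sequentially"
      using LIMSEQ_inverse_real_of_nat by (auto simp: filterlim_at)
    ultimately have "(\<lambda>k. q k y) \<longlonglongrightarrow> D"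
      unfolding q_def by (rule filterlim_compose)
    then show ?thesis unfolding R_def by (rule limI)
  qed
  have E_iff: "y \<in> E \<longleftrightarrow> (\<exists>D. ((\<lambda>t. g (y + t *\<^sub>R v)) has_field_derivative D) (at 0))" for y
  proof
    assume "y \<in> E"
    have "((\<lambda>t. g (y + t *\<^sub>R v)) has_derivative (*) (R y)) (at 0)"
      unfolding has_derivative_at_alt
    proof (intro conjI allI impI bounded_linear_mult_right)
      fix e :: real assume "0 < e"
      then obtain n where n: "inverse (real (Suc n)) < e" using reals_Archimedean by blast
      obtain N where N: "\<And>t::rat. \<bar>real_of_rat t\<bar> < inverse (real (Suc N)) \<Longrightarrow>
          \<bar>g (y + real_of_rat t *\<^sub>R v) - g y - R y * real_of_rat t\<bar> \<le> inverse (real (Suc n)) * \<bar>real_of_rat t\<bar>"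
        using \<open>y \<in> E\<close> unfolding E_def by blast
      define d where "d = inverse (real (Suc N))"
      have "\<bar>g (y + t *\<^sub>R v) - g y - R y * t\<bar> \<le> inverse (real (Suc n)) * \<bar>t\<bar>" if "\<bar>t\<bar> < d" for t
      proof (rule ccontr)
        define B where "B = {t. \<bar>t\<bar> < d} \<inter> {t. inverse (real (Suc n)) * \<bar>t\<bar> < \<bar>g (y + t *\<^sub>R v) - g y - R y * t\<bar>}"
        assume "\<not> ?thesis"
        then have "t \<in> B" using that by (simp add: B_def)
        moreover have "open B"
          unfolding B_def by (intro open_Int open_Collect_less continuous_intros comp)
        ultimately obtain a where "a > 0" and a: "\<And>s. dist s t < a \<Longrightarrow> s \<in> B"
          by (auto simp: open_dist)
        obtain r where r: "t < real_of_rat r" "real_of_rat r < t + a"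
          using Rats_dense_in_real[of t "t + a"] \<open>a > 0\<close> by (auto simp: Rats_def)
        then have "real_of_rat r \<in> B" by (intro a) (simp add: dist_real_def)
        then show False using N[of r] by (simp add: B_def d_def)
      qed
      then have "\<forall>t. norm (t - 0) < d \<longrightarrow>
          norm (g (y + t *\<^sub>R v) - g (y + 0 *\<^sub>R v) - R y * (t - 0)) \<le> e * norm (t - 0)"
        using n by (fastforce intro: order_trans mult_right_mono)
      moreover have "d > 0" by (simp add: d_def)
      ultimately show "\<exists>d>0. \<forall>t. norm (t - 0) < d \<longrightarrow>
          norm (g (y + t *\<^sub>R v) - g (y + 0 *\<^sub>R v) - R y * (t - 0)) \<le> e * norm (t - 0)"
        by blast
    qed
    then show "\<exists>D. ((\<lambda>t. g (y + t *\<^sub>R v)) has_field_derivative D) (at 0)"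
      by (auto simp: has_field_derivative_def)
  next
    assume "\<exists>D. ((\<lambda>t. g (y + t *\<^sub>R v)) has_field_derivative D) (at 0)"
    then have "((\<lambda>t. g (y + t *\<^sub>R v)) has_field_derivative R y) (at 0)"
      using R by blast
    then have lim: "\<forall>e>0. \<exists>d>0. \<forall>t. \<bar>t\<bar> < d \<longrightarrow> \<bar>g (y + t *\<^sub>R v) - g y - R y * t\<bar> \<le> e * \<bar>t\<bar>"
      by (simp add: has_field_derivative_def has_derivative_at_alt)
    show "y \<in> E"
      unfolding E_def
    proof safe
      fix n
      obtain d where "d > 0" and d: "\<And>t. \<bar>t\<bar> < d \<Longrightarrow> \<bar>g (y + t *\<^sub>R v) - g y - R y * t\<bar> \<le> inverse (real (Suc n)) * \<bar>t\<bar>"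
        using lim[rule_format, of "inverse (real (Suc n))"] by auto
      obtain N where "inverse (real (Suc N)) < d" using reals_Archimedean[OF \<open>d > 0\<close>] by blast
      then show "\<exists>N. \<forall>t::rat. \<bar>real_of_rat t\<bar> < inverse (real (Suc N)) \<longrightarrow>
        \<bar>g (y + real_of_rat t *\<^sub>R v) - g y - R y * real_of_rat t\<bar> \<le> inverse (real (Suc n)) * \<bar>real_of_rat t\<bar>"
        using d by (meson order_less_trans)
    qed
  qed
  have "deriv (\<lambda>t. g (y + t *\<^sub>R v)) 0 = (if y \<in> E then R y else (SOME D::real. False))" for y
  proof (cases "y \<in> E")
    case True
    then show ?thesis using R E_iff DERIV_imp_deriv by metis
  next
    case False
    then have "\<And>D. \<not> ((\<lambda>t. g (y + t *\<^sub>R v)) has_field_derivative D) (at 0)"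
      using E_iff by blast
    then show ?thesis using False by (simp add: deriv_def)
  qed
  then show ?thesis by simp
qed


section \<open>Integrability against the normal density\<close>

lemma prod_Basis_vec: "(\<Prod>b\<in>(Basis :: (real^'n) set). h (x \<bullet> b)) = (\<Prod>i\<in>UNIV. h (x $ i))"
  by (simp add: Basis_vec_def UNION_singleton_eq_range prod.reindex axis_eq_axis inj_on_def inner_axis)

text \<open>
  By Tonelli, the integral of the product is a power of the integral of \<open>h\<close>.
\<close>

lemma integrable_prod_coordinates:
  fixes h :: "real \<Rightarrow> real"
  assumes h: "integrable lborel h" and nonneg: "\<And>t. h t \<ge> 0"
  shows "integrable lborel (\<lambda>e::real^'n. \<Prod>i\<in>UNIV. h (e $ i))"
proof (rule integrableI_nonneg)
  have [measurable]: "h \<in> borel_measurable borel" using h by auto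
  show "(\<lambda>e::real^'n. \<Prod>i\<in>UNIV. h (e $ i)) \<in> borel_measurable lborel"
    unfolding prod_Basis_vec[symmetric] by measurable
  have "(\<integral>\<^sup>+e. ennreal (\<Prod>i\<in>UNIV. h (e $ i)) \<partial>(lborel :: (real^'n) measure))
      = (\<integral>\<^sup>+e. (\<Prod>b\<in>Basis. ennreal (h (e \<bullet> b))) \<partial>(lborel :: (real^'n) measure))"
    by (simp add: prod_Basis_vec[symmetric] prod_ennreal nonneg)
  also have "\<dots> = (\<Prod>b\<in>(Basis :: (real^'n) set). \<integral>\<^sup>+t. ennreal (h t) \<partial>lborel)"
    by (rule nn_integral_lborel_prod) (auto simp: nonneg)
  also have "\<dots> < \<infinity>"
    using h nonneg by (auto simp: nn_integral_eq_integral ennreal_prod_eq_top less_top prod_constant power_less_top_ennreal)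
  finally show "(\<integral>\<^sup>+e. ennreal (\<Prod>i\<in>UNIV. h (e $ i)) \<partial>(lborel :: (real^'n) measure)) < \<infinity>" .
qed (simp add: prod_nonneg nonneg)

text \<open>
  Completing the square; this reduces exponential moments of the normal distribution to
  the integrability of shifted normal densities.
\<close>

lemma exp_times_normal_density:
  assumes "\<sigma> > 0"
  shows "exp (c * t) * normal_density 0 \<sigma> t = exp (c\<^sup>2 * \<sigma>\<^sup>2 / 2) * normal_density (c * \<sigma>\<^sup>2) \<sigma> t"
proof -
  have "c * t - t\<^sup>2 / (2 * \<sigma>\<^sup>2) = c\<^sup>2 * \<sigma>\<^sup>2 / 2 - (t - c * \<sigma>\<^sup>2)\<^sup>2 / (2 * \<sigma>\<^sup>2)"
    using assms by (simp add: field_simps power2_eq_square)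
  then show ?thesis
    by (simp add: normal_density_def mult_exp_exp field_simps)
qed

lemma integrable_exp_abs_normal_density:
  assumes "\<sigma> > 0"
  shows "integrable lborel (\<lambda>t. exp (c * \<bar>t\<bar>) * normal_density 0 \<sigma> t)"
proof (rule Bochner_Integration.integrable_bound)
  show "integrable lborel (\<lambda>t. exp (c\<^sup>2 * \<sigma>\<^sup>2 / 2) * normal_density (c * \<sigma>\<^sup>2) \<sigma> t
      + exp ((-c)\<^sup>2 * \<sigma>\<^sup>2 / 2) * normal_density ((-c) * \<sigma>\<^sup>2) \<sigma> t)"
    using assms by (intro Bochner_Integration.integrable_add integrable_mult_right integrable_normal_density)
  show "AE t in lborel. norm (exp (c * \<bar>t\<bar>) * normal_density 0 \<sigma> t)
      \<le> norm (exp (c\<^sup>2 * \<sigma>\<^sup>2 / 2) * normal_density (c * \<sigma>\<^sup>2) \<sigma> t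
      + exp ((-c)\<^sup>2 * \<sigma>\<^sup>2 / 2) * normal_density ((-c) * \<sigma>\<^sup>2) \<sigma> t)"
    unfolding exp_times_normal_density[OF assms, symmetric]
  proof (intro AE_I2)
    fix t
    have "0 \<le> exp (c * t) * normal_density 0 \<sigma> t" "0 \<le> exp (- c * t) * normal_density 0 \<sigma> t"
      by simp_all
    then show "norm (exp (c * \<bar>t\<bar>) * normal_density 0 \<sigma> t)
        \<le> norm (exp (c * t) * normal_density 0 \<sigma> t + exp (- c * t) * normal_density 0 \<sigma> t)"
      by (cases "t \<ge> 0") simp_all
  qed
qed measurable

text \<open>
  The bound has the form of a product over coordinates, as does the density.  Exponential rather
  than polynomial growth is admitted because the shifts of the density in the
  proof of Stein's identity produce exponential factors.
\<close>

lemma integrable_isotropic_normal_exponential_growth: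
  fixes g :: "real^'n \<Rightarrow> real"
  assumes "\<sigma> > 0" and [measurable]: "g \<in> borel_measurable borel"
    and bound: "\<And>e. \<bar>g e\<bar> \<le> C * exp (c * (\<Sum>i\<in>UNIV. \<bar>e $ i\<bar>))"
  shows "integrable lborel (\<lambda>e. isotropic_normal_density \<sigma> e * g e)"
proof (rule Bochner_Integration.integrable_bound)
  show "integrable lborel (\<lambda>e::real^'n. C * (\<Prod>i\<in>UNIV. exp (c * \<bar>e $ i\<bar>) * normal_density 0 \<sigma> (e $ i)))"
    by (intro integrable_mult_right integrable_prod_coordinates integrable_exp_abs_normal_density) (auto simp: \<open>\<sigma> > 0\<close>)
  show "(\<lambda>e. isotropic_normal_density \<sigma> e * g e) \<in> borel_measurable lborel"
    unfolding isotropic_normal_density_def prod_Basis_vec[symmetric] by measurable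
  show "AE e in lborel. norm (isotropic_normal_density \<sigma> e * g e)
      \<le> norm (C * (\<Prod>i\<in>UNIV. exp (c * \<bar>e $ i\<bar>) * normal_density 0 \<sigma> (e $ i)))"
  proof (intro AE_I2)
    fix e :: "real^'n"
    have "norm (isotropic_normal_density \<sigma> e * g e) = isotropic_normal_density \<sigma> e * \<bar>g e\<bar>"
      by (simp add: abs_mult isotropic_normal_density_def prod_nonneg)
    also have "\<dots> \<le> isotropic_normal_density \<sigma> e * (C * exp (c * (\<Sum>i\<in>UNIV. \<bar>e $ i\<bar>)))"
      by (intro mult_left_mono bound) (simp add: isotropic_normal_density_def prod_nonneg)
    also have "\<dots> = C * (\<Prod>i\<in>UNIV. exp (c * \<bar>e $ i\<bar>) * normal_density 0 \<sigma> (e $ i))"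
      by (simp add: prod.distrib exp_sum sum_distrib_left isotropic_normal_density_def)
    finally show "norm (isotropic_normal_density \<sigma> e * g e)
      \<le> norm (C * (\<Prod>i\<in>UNIV. exp (c * \<bar>e $ i\<bar>) * normal_density 0 \<sigma> (e $ i)))"
      by simp
  qed
qed


section \<open>Stein's identity\<close>

lemma lborel_integral_translation:
  fixes F :: "'a::euclidean_space \<Rightarrow> real"
  assumes [measurable]: "F \<in> borel_measurable borel"
  shows "(\<integral>e. F (c + e) \<partial>lborel) = (\<integral>e. F e \<partial>lborel)"
    and "integrable lborel (\<lambda>e. F (c + e)) \<longleftrightarrow> integrable lborel F"
proof -
  have [measurable]: "(+) c \<in> borel_measurable borel"
    by (intro borel_measurable_continuous_onI continuous_intros)
  show "(\<integral>e. F (c + e) \<partial>lborel) = (\<integral>e. F e \<partial>lborel)"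
    by (subst (2) lborel_distr_plus[of c, symmetric], subst integral_distr) auto
  show "integrable lborel (\<lambda>e. F (c + e)) \<longleftrightarrow> integrable lborel F"
    by (subst (2) lborel_distr_plus[of c, symmetric], subst integrable_distr_eq) auto
qed

lemma AE_lborel_translation:
  fixes c :: "'a::euclidean_space"
  assumes "AE y in lborel. P y"
  shows "AE e in lborel. P (c + e)"
proof (rule AE_distrD[of "(+) c" lborel borel P])
  show "(+) c \<in> measurable lborel borel"
    by (auto intro!: borel_measurable_continuous_onI continuous_intros)
  show "AE y in distr lborel borel ((+) c). P y"
    unfolding lborel_distr_plus by (rule assms)
qed

text \<open>
  The likelihood ratio of a normal distribution and its translate by \<open>h\<close> in one coordinate.
\<close>

lemma isotropic_normal_density_shift:
  assumes "\<sigma> > 0"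
  shows "isotropic_normal_density \<sigma> (e - h *\<^sub>R axis i 1)
         = isotropic_normal_density \<sigma> e * exp ((h * e $ i - h\<^sup>2 / 2) / \<sigma>\<^sup>2)"
proof -
  have "normal_density 0 \<sigma> (t - h) = normal_density 0 \<sigma> t * exp ((h * t - h\<^sup>2 / 2) / \<sigma>\<^sup>2)" for t
  proof -
    have "- (t - h)\<^sup>2 / (2 * \<sigma>\<^sup>2) = - t\<^sup>2 / (2 * \<sigma>\<^sup>2) + (h * t - h\<^sup>2 / 2) / \<sigma>\<^sup>2"
      using assms by (simp add: field_simps power2_eq_square)
    then have "exp (- (t - h)\<^sup>2 / (2 * \<sigma>\<^sup>2)) = exp (- t\<^sup>2 / (2 * \<sigma>\<^sup>2)) * exp ((h * t - h\<^sup>2 / 2) / \<sigma>\<^sup>2)"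
      by (simp only: exp_add)
    then show ?thesis by (simp add: normal_density_def)
  qed
  then have "normal_density 0 \<sigma> ((e - h *\<^sub>R axis i 1) $ j)
      = normal_density 0 \<sigma> (e $ j) * (if j = i then exp ((h * e $ i - h\<^sup>2 / 2) / \<sigma>\<^sup>2) else 1)" for j
    by (simp add: axis_def)
  then show ?thesis
    by (simp add: isotropic_normal_density_def prod.distrib prod.delta)
qed

lemma abs_exp_minus_one_le: "\<bar>exp u - 1\<bar> \<le> \<bar>u\<bar> * exp \<bar>u\<bar>" for u :: real
proof (cases "u \<ge> 0")
  case True
  have "(1 - u) * exp u \<le> exp (- u) * exp u"
    using exp_ge_add_one_self[of "- u"] by (intro mult_right_mono) auto
  then show ?thesis using True by (simp add: mult_exp_exp algebra_simps)
next
  case False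
  have "1 - exp u \<le> \<bar>u\<bar> * 1"
    using exp_ge_add_one_self[of u] False by linarith
  also have "\<dots> \<le> \<bar>u\<bar> * exp \<bar>u\<bar>"
    by (intro mult_left_mono) auto
  finally show ?thesis using False by simp
qed

text \<open>
  A bound on the difference quotient of the likelihood ratio that is uniform in \<open>h\<close>, as
  dominated convergence needs it.  The exponent is at most \<open>h * a\<close> in absolute value for
  \<open>a = (\<bar>t\<bar> + 1) / s\<close>, so that the quotient is at most \<open>a exp a \<le> (exp a)\<^sup>2\<close>.
\<close>

lemma density_shift_quotient_bound:
  fixes h s t :: real
  assumes h: "0 < h" "h \<le> 1" and "s > 0"
  shows "\<bar>(exp ((h * t - h\<^sup>2 / 2) / s) - 1) / h\<bar> \<le> exp (2 / s) * exp (2 / s * \<bar>t\<bar>)"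
proof -
  define a where "a = (\<bar>t\<bar> + 1) / s"
  define u where "u = (h * t - h\<^sup>2 / 2) / s"
  have "a \<ge> 0" using \<open>s > 0\<close> by (simp add: a_def)
  have "\<bar>u\<bar> = h * (\<bar>t - h / 2\<bar> / s)"
  proof -
    have "u = h * ((t - h / 2) / s)" by (simp add: u_def power2_eq_square field_simps)
    then show ?thesis using h \<open>s > 0\<close> by (simp add: abs_mult)
  qed
  also have "\<dots> \<le> h * a"
    using h \<open>s > 0\<close> unfolding a_def by (intro mult_left_mono divide_right_mono) auto
  finally have u: "\<bar>u\<bar> \<le> h * a" .
  then have u': "\<bar>u\<bar> \<le> a"
    using h \<open>a \<ge> 0\<close> mult_right_mono[of h 1 a] by simp
  have "\<bar>exp u - 1\<bar> \<le> \<bar>u\<bar> * exp \<bar>u\<bar>" by (rule abs_exp_minus_one_le)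
  also have "\<dots> \<le> (h * a) * exp a"
    using u u' h \<open>a \<ge> 0\<close> by (intro mult_mono) auto
  finally have "\<bar>exp u - 1\<bar> / h \<le> a * exp a"
    using h by (simp add: field_simps)
  also have "\<dots> \<le> exp a * exp a"
    using exp_ge_add_one_self[of a] by (intro mult_right_mono exp_ge_zero) linarith
  also have "\<dots> = exp (2 / s) * exp (2 / s * \<bar>t\<bar>)"
    by (simp add: a_def mult_exp_exp add_divide_distrib)
  finally show ?thesis using h by (simp add: u_def)
qed

text \<open>
  The derivative at \<open>h = 0\<close> of \<open>\<integral> \<rho>(e) g(e + h a) de = \<integral> \<rho>(e - h a) g(e) de\<close>, where \<open>a\<close> is the
  \<open>i\<close>-th unit vector, taken on both sides under the integral sign.  On the left the difference
  quotients are bounded by the Lipschitz constant, on the right by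
  \<open>density_shift_quotient_bound\<close>.  In contrast to integration by parts on lines,
  this way needs no absolute continuity theory.
\<close>

lemma stein_identity:
  fixes g :: "real^'n \<Rightarrow> real"
  assumes "\<sigma> > 0" and lip: "\<And>u v. \<bar>g u - g v\<bar> \<le> K * dist u v"
    and diff: "AE e in lborel. (\<lambda>t. g (e + t *\<^sub>R axis i 1)) field_differentiable (at 0)"
  defines "D \<equiv> \<lambda>e. deriv (\<lambda>t. g (e + t *\<^sub>R axis i 1)) 0"
  shows "integrable lborel (\<lambda>e. isotropic_normal_density \<sigma> e * D e)"
    and "integrable lborel (\<lambda>e. isotropic_normal_density \<sigma> e * (g e * e $ i))"
    and "(\<integral>e. isotropic_normal_density \<sigma> e * (g e * e $ i) \<partial>lborel)
         = \<sigma>\<^sup>2 * (\<integral>e. isotropic_normal_density \<sigma> e * D e \<partial>lborel)"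
proof -
  define \<rho> where "\<rho> = (isotropic_normal_density \<sigma> :: real^'n \<Rightarrow> real)"
  define a :: "real^'n" where "a = axis i 1"
  define h where "h k = inverse (real (Suc k))" for k
  have h: "0 < h k" "h k \<le> 1" for k
    by (auto simp: h_def field_simps)
  have h_lim: "filterlim h (at 0) sequentially"
    unfolding h_def [abs_def] using LIMSEQ_inverse_real_of_nat by (auto simp: filterlim_at)
  have "norm a = 1" by (simp add: a_def)
  have "\<bar>g (axis i 1) - g 0\<bar> \<le> K * 1"
    using lip[of "axis i 1" 0] by simp
  then have "K \<ge> 0" by linarith
  have "continuous_on UNIV g"
    using lip \<open>K \<ge> 0\<close>
    by (intro lipschitz_on_continuous_on[of K]) (auto simp: lipschitz_on_def dist_real_def)
  have [measurable]: "g \<in> borel_measurable borel"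
    using \<open>continuous_on UNIV g\<close> by (rule borel_measurable_continuous_onI)
  have [measurable]: "D \<in> borel_measurable borel"
    unfolding D_def using \<open>continuous_on UNIV g\<close> by (rule borel_measurable_deriv_along)
  have [measurable]: "\<rho> \<in> borel_measurable borel"
    unfolding \<rho>_def isotropic_normal_density_def prod_Basis_vec[symmetric] by measurable
  have [measurable]: "(\<lambda>e::real^'n. e $ i) \<in> borel_measurable borel"
    by (intro borel_measurable_continuous_onI continuous_intros)
  have \<rho>_nonneg: "\<rho> e \<ge> 0" for e
    by (simp add: \<rho>_def isotropic_normal_density_def prod_nonneg)
  note int = integrable_isotropic_normal_exponential_growth[where 'n = 'n, OF \<open>\<sigma> > 0\<close>, folded \<rho>_def]

  define C where "C = \<bar>g 0\<bar> + K"
  have growth: "\<bar>g (e + s *\<^sub>R a)\<bar> \<le> C * exp (1 * (\<Sum>j\<in>UNIV. \<bar>e $ j\<bar>))" if "\<bar>s\<bar> \<le> 1" for e s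
  proof -
    define n where "n = (\<Sum>j\<in>UNIV. \<bar>e $ j\<bar>)"
    have "norm (e + s *\<^sub>R a) \<le> norm e + norm (s *\<^sub>R a)" by (rule norm_triangle_ineq)
    also have "\<dots> \<le> n + 1"
      using norm_le_l1_cart[of e] that by (simp add: n_def \<open>norm a = 1\<close>)
    finally have "K * norm (e + s *\<^sub>R a) \<le> K * (n + 1)"
      using \<open>K \<ge> 0\<close> by (rule mult_left_mono)
    then have "\<bar>g (e + s *\<^sub>R a)\<bar> \<le> \<bar>g 0\<bar> * 1 + K * (n + 1)"
      using lip[of "e + s *\<^sub>R a" 0] by simp
    also have "\<dots> \<le> \<bar>g 0\<bar> * exp n + K * exp n"
    proof (intro add_mono mult_left_mono)
      show "n + 1 \<le> exp n"
        using exp_ge_add_one_self[of n] by linarith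
      show "1 \<le> exp n"
        by (simp add: n_def sum_nonneg)
    qed (use \<open>K \<ge> 0\<close> in auto)
    also have "\<dots> \<le> C * exp n"
      using \<open>K \<ge> 0\<close> by (simp add: C_def distrib_right)
    finally show ?thesis by (simp add: n_def)
  qed
  have "C \<ge> 0" using \<open>K \<ge> 0\<close> by (simp add: C_def)
  have int_g: "integrable lborel (\<lambda>e. \<rho> e * g (e + s *\<^sub>R a))" if "\<bar>s\<bar> \<le> 1" for s
    using growth[OF that] by (intro int[of "\<lambda>e. g (e + s *\<^sub>R a)" C 1]) simp_all
  have int_1: "integrable lborel \<rho>"
    using int[of "\<lambda>_. 1" 1 0] by simp

  \<comment> \<open>difference quotients with the increment in \<open>g\<close>\<close>
  define S where "S k e = \<rho> e * ((g (e + h k *\<^sub>R a) - g e) / h k)" for k e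
  have S_bound: "AE e in lborel. norm (S k e) \<le> K * \<rho> e" for k
  proof (intro AE_I2)
    fix e
    have "\<bar>(g (e + h k *\<^sub>R a) - g e) / h k\<bar> \<le> K"
      using lip[of "e + h k *\<^sub>R a" e] h[of k] \<open>norm a = 1\<close> by (simp add: dist_norm field_simps)
    then have "\<rho> e * \<bar>(g (e + h k *\<^sub>R a) - g e) / h k\<bar> \<le> \<rho> e * K"
      using \<rho>_nonneg by (rule mult_left_mono)
    then show "norm (S k e) \<le> K * \<rho> e"
      using \<rho>_nonneg[of e] by (simp add: S_def abs_mult mult.commute)
  qed
  have S_lim: "AE e in lborel. (\<lambda>k. S k e) \<longlonglongrightarrow> \<rho> e * D e"
    using diff
  proof eventually_elim
    case (elim e)
    then have "((\<lambda>t. g (e + t *\<^sub>R a)) has_field_derivative D e) (at 0)"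
      by (simp add: D_def a_def field_differentiable_derivI)
    then have "((\<lambda>t. (g (e + t *\<^sub>R a) - g e) / t) \<longlongrightarrow> D e) (at 0)"
      by (simp add: has_field_derivative_iff)
    then have "(\<lambda>k. (g (e + h k *\<^sub>R a) - g e) / h k) \<longlonglongrightarrow> D e"
      using h_lim by (rule filterlim_compose)
    then show ?case unfolding S_def by (intro tendsto_intros)
  qed
  have S_meas: "S k \<in> borel_measurable lborel" for k
    unfolding S_def by measurable
  have "integrable lborel (\<lambda>e. K * \<rho> e)" using int_1 by simp
  note S_dct = this S_lim S_bound
  show "integrable lborel (\<lambda>e. isotropic_normal_density \<sigma> e * D e)"
    by (fold \<rho>_def, rule integrable_dominated_convergence[OF _ S_meas S_dct]) measurable
  have S_int: "(\<lambda>k. integral\<^sup>L lborel (S k)) \<longlonglongrightarrow> (\<integral>e. \<rho> e * D e \<partial>lborel)"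
    by (rule integral_dominated_convergence[OF _ S_meas S_dct]) measurable

  \<comment> \<open>difference quotients with the increment moved to the density\<close>
  define r where "r k t = (exp ((h k * t - (h k)\<^sup>2 / 2) / \<sigma>\<^sup>2) - 1) / h k" for k t
  define T where "T k e = \<rho> e * (r k (e $ i) * g e)" for k e
  have T_eq: "T k e = (\<rho> (e - h k *\<^sub>R a) * g e - \<rho> e * g e) / h k" for k e
    unfolding T_def r_def \<rho>_def a_def isotropic_normal_density_shift[OF \<open>\<sigma> > 0\<close>]
    using h[of k] by (simp add: field_simps)
  have ST: "integral\<^sup>L lborel (S k) = integral\<^sup>L lborel (T k)" for k
  proof -
    define F where "F e = \<rho> (e - h k *\<^sub>R a) * g e" for e
    have [measurable]: "F \<in> borel_measurable borel" unfolding F_def by measurable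
    have F_shift: "(\<lambda>e. F (h k *\<^sub>R a + e)) = (\<lambda>e. \<rho> e * g (e + h k *\<^sub>R a))"
      by (simp add: F_def add.commute)
    have int_s: "integrable lborel (\<lambda>e. \<rho> e * g (e + h k *\<^sub>R a))" and int_0: "integrable lborel (\<lambda>e. \<rho> e * g e)"
      using int_g[of "h k"] int_g[of 0] h[of k] by auto
    have "integrable lborel F"
      using int_s lborel_integral_translation(2)[of F "h k *\<^sub>R a"] by (simp add: F_shift)
    have "integral\<^sup>L lborel (S k) = (\<integral>e. (\<rho> e * g (e + h k *\<^sub>R a) - \<rho> e * g e) / h k \<partial>lborel)"
      by (rule Bochner_Integration.integral_cong) (simp_all add: S_def right_diff_distrib)
    also have "\<dots> = ((\<integral>e. \<rho> e * g (e + h k *\<^sub>R a) \<partial>lborel) - (\<integral>e. \<rho> e * g e \<partial>lborel)) / h k"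
      using int_s int_0 by simp
    also have "(\<integral>e. \<rho> e * g (e + h k *\<^sub>R a) \<partial>lborel) = (\<integral>e. F e \<partial>lborel)"
      using lborel_integral_translation(1)[of F "h k *\<^sub>R a"] by (simp add: F_shift)
    also have "((\<integral>e. F e \<partial>lborel) - (\<integral>e. \<rho> e * g e \<partial>lborel)) / h k = (\<integral>e. (F e - \<rho> e * g e) / h k \<partial>lborel)"
      using \<open>integrable lborel F\<close> int_0 by simp
    also have "\<dots> = integral\<^sup>L lborel (T k)"
      by (rule Bochner_Integration.integral_cong) (simp_all add: T_eq F_def)
    finally show ?thesis .
  qed
  define c where "c = 2 / \<sigma>\<^sup>2"
  have "c > 0" using \<open>\<sigma> > 0\<close> by (simp add: c_def)
  \<comment> \<open>one factor comes from the growth of \<open>g\<close>, the other from the likelihood ratio\<close>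
  define B where "B e = (exp c * C) * exp ((c + 1) * (\<Sum>j\<in>UNIV. \<bar>e $ j\<bar>))" for e :: "real^'n"
  have B_bound: "\<bar>x * g e\<bar> \<le> B e" if "\<bar>x\<bar> \<le> exp c * exp (c * \<bar>e $ i\<bar>)" for x e
  proof -
    have "\<bar>e $ i\<bar> \<le> (\<Sum>j\<in>UNIV. \<bar>e $ j\<bar>)"
      by (rule member_le_sum) auto
    then have "exp (c * \<bar>e $ i\<bar>) \<le> exp (c * (\<Sum>j\<in>UNIV. \<bar>e $ j\<bar>))"
      using \<open>c > 0\<close> by simp
    then have "\<bar>x\<bar> \<le> exp c * exp (c * (\<Sum>j\<in>UNIV. \<bar>e $ j\<bar>))"
      using that by (meson mult_left_mono exp_ge_zero order_trans)
    then have "\<bar>x\<bar> * \<bar>g e\<bar> \<le> (exp c * exp (c * (\<Sum>j\<in>UNIV. \<bar>e $ j\<bar>))) * (C * exp (\<Sum>j\<in>UNIV. \<bar>e $ j\<bar>))"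
      using growth[of 0 e] by (intro mult_mono) auto
    also have "\<dots> = B e"
      by (simp add: B_def distrib_right exp_add)
    finally show ?thesis by (simp add: abs_mult)
  qed
  have [measurable]: "B \<in> borel_measurable borel"
    unfolding B_def by (intro borel_measurable_continuous_onI continuous_intros)
  have "B e \<ge> 0" for e
    using \<open>C \<ge> 0\<close> by (simp add: B_def)
  then have int_B: "integrable lborel (\<lambda>e. \<rho> e * B e)"
    by (intro int[of B "exp c * C" "c + 1"]) (simp_all add: B_def)
  have T_bound: "AE e in lborel. norm (T k e) \<le> \<rho> e * B e" for k
  proof (intro AE_I2)
    fix e
    have "\<bar>r k (e $ i)\<bar> \<le> exp c * exp (c * \<bar>e $ i\<bar>)"
      unfolding r_def c_def using h \<open>\<sigma> > 0\<close> by (intro density_shift_quotient_bound) auto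
    then have "\<bar>r k (e $ i) * g e\<bar> \<le> B e" by (rule B_bound)
    then show "norm (T k e) \<le> \<rho> e * B e"
      using \<rho>_nonneg[of e] by (simp add: T_def abs_mult[of "\<rho> e"] mult_left_mono)
  qed
  have T_lim: "AE e in lborel. (\<lambda>k. T k e) \<longlonglongrightarrow> \<rho> e * (e $ i / \<sigma>\<^sup>2 * g e)"
  proof (intro AE_I2)
    fix e
    have "((\<lambda>s. exp ((s * e $ i - s\<^sup>2 / 2) / \<sigma>\<^sup>2)) has_field_derivative e $ i / \<sigma>\<^sup>2) (at 0)"
      using \<open>\<sigma> > 0\<close> by (auto intro!: derivative_eq_intros simp: power2_eq_square power4_eq_xxxx)
    then have "((\<lambda>s. (exp ((s * e $ i - s\<^sup>2 / 2) / \<sigma>\<^sup>2) - 1) / s) \<longlongrightarrow> e $ i / \<sigma>\<^sup>2) (at 0)"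
      by (simp add: has_field_derivative_iff)
    then have "(\<lambda>k. r k (e $ i)) \<longlonglongrightarrow> e $ i / \<sigma>\<^sup>2"
      unfolding r_def using h_lim by (rule filterlim_compose)
    then show "(\<lambda>k. T k e) \<longlonglongrightarrow> \<rho> e * (e $ i / \<sigma>\<^sup>2 * g e)"
      unfolding T_def by (intro tendsto_intros)
  qed
  have T_meas: "T k \<in> borel_measurable lborel" for k
    unfolding T_def r_def by measurable
  have T_int: "(\<lambda>k. integral\<^sup>L lborel (T k)) \<longlonglongrightarrow> (\<integral>e. \<rho> e * (e $ i / \<sigma>\<^sup>2 * g e) \<partial>lborel)"
    by (rule integral_dominated_convergence[OF _ T_meas int_B T_lim T_bound]) measurable
  have int_T: "integrable lborel (\<lambda>e. \<rho> e * (e $ i / \<sigma>\<^sup>2 * g e))"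
    by (rule integrable_dominated_convergence[OF _ T_meas int_B T_lim T_bound]) measurable
  have scale: "\<rho> e * (g e * e $ i) = \<sigma>\<^sup>2 * (\<rho> e * (e $ i / \<sigma>\<^sup>2 * g e))" for e
    using \<open>\<sigma> > 0\<close> by simp
  show "integrable lborel (\<lambda>e. isotropic_normal_density \<sigma> e * (g e * e $ i))"
    unfolding \<rho>_def[symmetric] scale using int_T by (rule integrable_mult_right)
  have "(\<integral>e. \<rho> e * (e $ i / \<sigma>\<^sup>2 * g e) \<partial>lborel) = (\<integral>e. \<rho> e * D e \<partial>lborel)"
    using LIMSEQ_unique[OF T_int] S_int by (simp add: ST)
  then show "(\<integral>e. isotropic_normal_density \<sigma> e * (g e * e $ i) \<partial>lborel)
      = \<sigma>\<^sup>2 * (\<integral>e. isotropic_normal_density \<sigma> e * D e \<partial>lborel)"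
    unfolding \<rho>_def[symmetric] scale integral_mult_right_zero by (rule arg_cong)
qed


section \<open>Degrees of freedom\<close>

text \<open>
  Stein's identity in each coordinate.  The expectations of the noise vanish by the same
  identity for a constant function, so that covariances with \<open>Y\<close> are expectations of products
  with \<open>\<epsilon>\<close>.
\<close>

lemma df_nonexpansive:
  fixes f :: "real^'n::finite \<Rightarrow> real^'n"
  assumes lip: "\<And>y y'. dist (f y) (f y') \<le> dist y y'"
    and diff: "AE y in lebesgue. has_diagonal_partials f y"
    and M: "prob_space M" and "\<sigma> > 0"
    and \<epsilon>: "distributed M lborel \<epsilon> (\<lambda>e. ennreal (isotropic_normal_density \<sigma> e))"
    and Y: "\<And>\<omega>. Y \<omega> = \<mu> + \<epsilon> \<omega>"
  shows "has_covariance M (\<lambda>\<omega>. f (Y \<omega>) $ i) (\<lambda>\<omega>. Y \<omega> $ i)"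
    and "integrable M (\<lambda>\<omega>. divergence f (Y \<omega>))"
    and "degrees_of_freedom M \<sigma> Y f = integral\<^sup>L M (\<lambda>\<omega>. divergence f (Y \<omega>))"
proof -
  interpret prob_space M by (rule M)
  let ?\<rho> = "isotropic_normal_density \<sigma> :: real^'n \<Rightarrow> real"
  have \<rho>: "?\<rho> e \<ge> 0" for e by (simp add: isotropic_normal_density_def prod_nonneg)
  define g where "g i e = f (\<mu> + e) $ i" for i e
  define D where "D i e = deriv (\<lambda>t. g i (e + t *\<^sub>R axis i 1)) 0" for i e
  have g_lip: "\<bar>g i u - g i v\<bar> \<le> 1 * dist u v" for i u v
  proof -
    have "\<bar>g i u - g i v\<bar> \<le> dist (f (\<mu> + u)) (f (\<mu> + v))"
      unfolding g_def dist_norm vector_minus_component[symmetric] by (rule component_le_norm_cart)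
    also have "\<dots> \<le> dist u v"
      using lip[of "\<mu> + u" "\<mu> + v"] by simp
    finally show ?thesis by simp
  qed
  have g_cont: "continuous_on UNIV (g i)" for i
    using g_lip[of i] by (intro lipschitz_on_continuous_on[of 1]) (auto simp: lipschitz_on_def dist_real_def)
  have [measurable]: "g i \<in> borel_measurable borel" for i
    using g_cont by (rule borel_measurable_continuous_onI)
  have [measurable]: "D i \<in> borel_measurable borel" for i
    unfolding D_def using g_cont by (rule borel_measurable_deriv_along)
  have [measurable]: "(\<lambda>e::real^'n. e $ i) \<in> borel_measurable borel" for i
    by (intro borel_measurable_continuous_onI continuous_intros)
  have "AE e in lborel. has_diagonal_partials f (\<mu> + e)"
    using diff by (intro AE_lborel_translation) (simp add: AE_completion_iff)
  then have "AE e in lborel. (\<lambda>t. g i (e + t *\<^sub>R axis i 1)) field_differentiable (at 0)" for i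
    by eventually_elim (simp add: has_diagonal_partials_def g_def add.assoc)
  note stein = stein_identity[OF \<open>\<sigma> > 0\<close> g_lip this, folded D_def]
  \<comment> \<open>the noise has mean zero, by the choice \<open>g = 1\<close>\<close>
  note stein_1 = stein_identity[OF \<open>\<sigma> > 0\<close>, of "\<lambda>_. 1" 0, simplified]
  note tr = distributed_integral[OF \<epsilon> _ \<rho>] distributed_integrable[OF \<epsilon> _ \<rho>]

  have int_\<epsilon>: "integrable M (\<lambda>\<omega>. \<epsilon> \<omega> $ i)" and E_\<epsilon>: "expectation (\<lambda>\<omega>. \<epsilon> \<omega> $ i) = 0" for i
    using stein_1(2,3)[of i] tr(1)[of "\<lambda>e. e $ i"] tr(2)[of "\<lambda>e. e $ i"] by simp_all
  have int_g: "integrable M (\<lambda>\<omega>. g i (\<epsilon> \<omega>))" for i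
  proof -
    have "integrable M (\<lambda>\<omega>. \<bar>g i 0\<bar> + (\<Sum>j\<in>UNIV. \<bar>\<epsilon> \<omega> $ j\<bar>))"
      using int_\<epsilon> by (intro Bochner_Integration.integrable_add integrable_const Bochner_Integration.integrable_sum integrable_abs)
    then show ?thesis
    proof (rule Bochner_Integration.integrable_bound)
      have [measurable]: "\<epsilon> \<in> measurable M borel"
        using distributed_measurable[OF \<epsilon>] by simp
      show "(\<lambda>\<omega>. g i (\<epsilon> \<omega>)) \<in> borel_measurable M" by measurable
      show "AE \<omega> in M. norm (g i (\<epsilon> \<omega>)) \<le> norm (\<bar>g i 0\<bar> + (\<Sum>j\<in>UNIV. \<bar>\<epsilon> \<omega> $ j\<bar>))"
      proof (intro AE_I2)
        fix \<omega>
        have "\<bar>g i (\<epsilon> \<omega>)\<bar> \<le> \<bar>g i 0\<bar> + norm (\<epsilon> \<omega>)"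
          using g_lip[of i "\<epsilon> \<omega>" 0] by simp
        then show "norm (g i (\<epsilon> \<omega>)) \<le> norm (\<bar>g i 0\<bar> + (\<Sum>j\<in>UNIV. \<bar>\<epsilon> \<omega> $ j\<bar>))"
          using norm_le_l1_cart[of "\<epsilon> \<omega>"] by simp
      qed
    qed
  qed
  have int_g\<epsilon>: "integrable M (\<lambda>\<omega>. g i (\<epsilon> \<omega>) * \<epsilon> \<omega> $ i)" for i
    using stein(2)[of i] tr(2)[of "\<lambda>e. g i e * e $ i"] by simp
  have int_D: "integrable M (\<lambda>\<omega>. D i (\<epsilon> \<omega>))" for i
    using stein(1)[of i] tr(2)[of "D i"] by simp
  have E_g\<epsilon>: "expectation (\<lambda>\<omega>. g i (\<epsilon> \<omega>) * \<epsilon> \<omega> $ i) = \<sigma>\<^sup>2 * expectation (\<lambda>\<omega>. D i (\<epsilon> \<omega>))" for i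
    using stein(3)[of i] tr(1)[of "\<lambda>e. g i e * e $ i"] tr(1)[of "D i"] by simp
  have fY: "f (Y \<omega>) $ i = g i (\<epsilon> \<omega>)" for i \<omega>
    by (simp add: Y g_def)
  have div: "divergence f (Y \<omega>) = (\<Sum>i\<in>UNIV. D i (\<epsilon> \<omega>))" for \<omega>
    by (simp add: divergence_def D_def g_def Y add.assoc)
  show "integrable M (\<lambda>\<omega>. divergence f (Y \<omega>))"
    unfolding div using int_D by (intro Bochner_Integration.integrable_sum)
  show "has_covariance M (\<lambda>\<omega>. f (Y \<omega>) $ i) (\<lambda>\<omega>. Y \<omega> $ i)"
    unfolding has_covariance_def fY using int_g[of i] int_\<epsilon>[of i] int_g\<epsilon>[of i]
    by (simp add: Y distrib_left)
  have "covariance M (\<lambda>\<omega>. f (Y \<omega>) $ i) (\<lambda>\<omega>. Y \<omega> $ i) = \<sigma>\<^sup>2 * expectation (\<lambda>\<omega>. D i (\<epsilon> \<omega>))" for i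
  proof -
    have "expectation (\<lambda>\<omega>. Y \<omega> $ i) = \<mu> $ i"
      using int_\<epsilon>[of i] by (simp add: Y E_\<epsilon> prob_space)
    then have "covariance M (\<lambda>\<omega>. f (Y \<omega>) $ i) (\<lambda>\<omega>. Y \<omega> $ i)
        = expectation (\<lambda>\<omega>. g i (\<epsilon> \<omega>) * \<epsilon> \<omega> $ i - expectation (\<lambda>\<omega>. g i (\<epsilon> \<omega>)) * \<epsilon> \<omega> $ i)"
      by (simp add: covariance_def fY left_diff_distrib) (simp add: Y)
    also have "\<dots> = expectation (\<lambda>\<omega>. g i (\<epsilon> \<omega>) * \<epsilon> \<omega> $ i)"
      using int_\<epsilon>[of i] int_g\<epsilon>[of i] by (simp add: E_\<epsilon>)
    finally show ?thesis by (simp add: E_g\<epsilon>)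
  qed
  then show "degrees_of_freedom M \<sigma> Y f = integral\<^sup>L M (\<lambda>\<omega>. divergence f (Y \<omega>))"
    unfolding degrees_of_freedom_def div using int_D \<open>\<sigma> > 0\<close>
    by (simp add: sum_distrib_left[symmetric])
qed

theorem proposition6p1:
  fixes x :: "'n::finite \<Rightarrow> real^'d::finite"
    and k :: "'d \<Rightarrow> nat"
    and D :: "'d \<Rightarrow> nat \<Rightarrow> nat \<Rightarrow> real"
    and P :: "'d \<Rightarrow> nat \<Rightarrow> 'n \<Rightarrow> real"
    and m :: "'d \<Rightarrow> nat"
    and q :: "'d \<Rightarrow> nat \<Rightarrow> real^'n"
    and \<tau> \<sigma> :: real
    and \<theta>0 :: "real^'n \<Rightarrow> real"
    and \<theta> :: "real^'n \<Rightarrow> 'd \<Rightarrow> real^'n"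
    and fit :: "real^'n \<Rightarrow> real^'n"
    and M :: "'a measure"
    and \<theta>star :: "real^'n"
    and \<epsilon> Y :: "'a \<Rightarrow> real^'n"
  assumes "\<tau> > 0"
    and "\<And>j. difference_matrix CARD('n) (k j) (D j)"
    and "\<And>j. sorting_permutation_matrix (\<lambda>i. x i $ j) (P j)"
    and "\<And>j. m j = CARD('n) - k j"
    and "\<And>j r. q j r = matrix_product_row (D j) (P j) r"
    and "\<And>y. gtv_solution \<tau> m q y (\<theta>0 y) (\<theta> y)"
    and "\<And>y. fit y = (\<Sum>j\<in>UNIV. \<theta> y j) + \<theta>0 y *\<^sub>R 1"
    and "prob_space M"
    and "\<sigma> > 0"
    and "distributed M lborel \<epsilon> (\<lambda>e. ennreal (isotropic_normal_density \<sigma> e))"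
    and "\<And>\<omega>. Y \<omega> = \<theta>star + \<epsilon> \<omega>"
  shows "(AE y in lebesgue. has_diagonal_partials fit y \<and>
            divergence fit y = real (dim (span ({1} \<union> (\<Union>j. ker_K (m j) (q j) (\<theta> y j)))))) \<and>
         (\<forall>i. has_covariance M (\<lambda>\<omega>. fit (Y \<omega>) $ i) (\<lambda>\<omega>. Y \<omega> $ i)) \<and>
         integrable M (\<lambda>\<omega>. divergence fit (Y \<omega>)) \<and>
         degrees_of_freedom M \<sigma> Y fit = integral\<^sup>L M (\<lambda>\<omega>. divergence fit (Y \<omega>))"
proof -
  note sol = assms(6) and fit = assms(7)
  have local: "AE y in lebesgue. has_diagonal_partials fit y \<and>
      divergence fit y = real (dim (span ({1} \<union> (\<Union>j. ker_K (m j) (q j) (\<theta> y j)))))"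
    using AE_fit_locally_affine[OF \<open>\<tau> > 0\<close> sol fit]
  proof eventually_elim
    case (elim y)
    then obtain L c where "linear L" and L: "\<forall>\<^sub>F z in nhds y. fit z = L z + c"
      and tr: "(\<Sum>i\<in>UNIV. L (axis i 1) $ i) = real (dim (span ({1} \<union> (\<Union>j. ker_K (m j) (q j) (\<theta> y j)))))"
      by blast
    show ?case
      using partials_of_locally_affine[OF \<open>linear L\<close> L] unfolding tr by (rule conjI)
  qed
  have lip: "dist (fit y) (fit y') \<le> dist y y'" for y y'
    unfolding fit by (rule fitted_vector_nonexpansive[OF sol sol \<open>\<tau> > 0\<close>])
  have "AE y in lebesgue. has_diagonal_partials fit y"
    using local by (rule AE_mp) simp
  note df = df_nonexpansive[OF lip this assms(8-11)]
  show ?thesis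
    by (intro conjI allI local df)
qed

end
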